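(* Let $p$ be a prime and $n \geq 1$ an integer. For any index $i \geq 0$, the minimal polynomial expression of the function $\varphi_i \colon (\mathbb{F}_p)^n \to \mathbb{F}_p$ (the $p^i$'s-place digit of the $p$-ary sum of $n$ single-digit integers) is given by $$\varphi_i(x_1,\dots,x_n) = \sum_{d_1,\dots,d_n} \prod_{j=1}^{n} \left( \frac{1}{d_j!} \right)^{\langle p \rangle} x_j (x_j-1) \cdots (x_j-d_j+1),$$ where the sum on the right-hand side is taken over all tuples $(d_1,\dots,d_n)$ of integers $d_1,\dots,d_n \in \{0,1,\dots,p-1\}$ with $d_1 + \cdots + d_n = p^i$.
   Context: Let $p$ be a prime. For $a \in \mathbb{F}_p = \mathbb{Z}/p\mathbb{Z}$, let $a_{\mathbb{Z}} \in \{0,1,\dots,p-1\} \subset \mathbb{Z}$ denote the representative of the residue class $a$ in that range. For $n \geq 1$, the functions $\varphi_i \colon (\mathbb{F}_p)^n \to \mathbb{F}_p$, $i = 0,1,2,\dots$, are defined by the relation in $\mathbb{Z}$ $$\sum_{j=1}^{n} (x_j)_{\mathbb{Z}} = \sum_{i \geq 0} \varphi_i(x_1,\dots,x_n)_{\mathbb{Z}} \, p^i \qquad (x_1,\dots,x_n \in \mathbb{F}_p),$$ i.e. $\varphi_i(x_1,\dots,x_n)_{\mathbb{Z}}$ is the $i$-th base-$p$ digit of the integer $(x_1)_{\mathbb{Z}} + \cdots + (x_n)_{\mathbb{Z}}$. A polynomial $\varphi \in \mathbb{F}_p[x_1,\dots,x_n]$ is a polynomial expression of a function $f \colon (\mathbb{F}_p)^n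 \to \mathbb{F}_p$ if $\varphi(x_1,\dots,x_n) = f(x_1,\dots,x_n)$ for all $(x_1,\dots,x_n) \in (\mathbb{F}_p)^n$. The minimal polynomial expression of $f$ is the unique polynomial expression of $f$ that has degree at most $p-1$ with respect to each variable. A function is identified with its minimal polynomial expression. For a positive integer $m$ and a rational number $a = \alpha/\beta$ with $\alpha,\beta \in \mathbb{Z}$, $\gcd(\beta,m) = 1$, define $a^{\langle m \rangle} = \alpha \cdot \beta^{-1} \in \mathbb{Z}/m\mathbb{Z}$, where $\beta^{-1}$ is the inverse of $\beta$ in $\mathbb{Z}/m\mathbb{Z}$ (independent of the choice of the fraction). For $d_j = 0$ the product $x_j(x_j-1)\cdots(x_j-d_j+1)$ is the empty product $1$. *)

theory Defs
  imports
    "HOL-Library.Poly_Mapping"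
    "Berlekamp_Zassenhaus.Finite_Field"
begin

text \<open>
  The field with \<open>p\<close> elements is \<^typ>\<open>'p::prime_card mod_ring\<close>, where \<open>p = CARD('p)\<close> is prime by the
  class \<^class>\<open>prime_card\<close>; the representative of a residue class in \<open>{0..<p}\<close> is
  \<^const>\<open>to_int_mod_ring\<close>. Affine \<open>n\<close>-space over it is \<^typ>\<open>'n::finite \<Rightarrow> 'p mod_ring\<close>, with
  \<open>n = CARD('n) \<ge> 1\<close>.
\<close>

definition digit_fun :: "nat \<Rightarrow> ('n::finite \<Rightarrow> 'p::prime_card mod_ring) \<Rightarrow> 'p mod_ring" where
  "digit_fun i x =
     of_int ((\<Sum>j\<in>UNIV. to_int_mod_ring (x j)) div int CARD('p) ^ i mod int CARD('p))"

lemma to_int_of_int_mod_ring: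
  "to_int_mod_ring (of_int k :: 'p::prime_card mod_ring) = k mod int CARD('p)"
  unfolding of_int_of_int_mod_ring by transfer simp

lemma to_int_mod_ring_range:
  "0 \<le> to_int_mod_ring (x :: 'p::prime_card mod_ring)" 
  "to_int_mod_ring (x :: 'p::prime_card mod_ring) < int CARD('p)"
  using range_to_int_mod_ring[where 'a='p] by (metis UNIV_I image_eqI atLeastLessThan_iff)+

lemma to_int_digit_fun:
  "to_int_mod_ring (digit_fun i (x :: 'n::finite \<Rightarrow> 'p::prime_card mod_ring)) =
     (\<Sum>j\<in>UNIV. to_int_mod_ring (x j)) div int CARD('p) ^ i mod int CARD('p)"
  by (simp add: digit_fun_def to_int_of_int_mod_ring)

lemma digit_expansion:
  fixes S b :: int
  assumes "b > 1" "0 \<le> S" "S < b ^ N"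
  shows "S = (\<Sum>i<N. (S div b ^ i mod b) * b ^ i)"
  using assms(2,3)
proof (induction N arbitrary: S)
  case (Suc N)
  have "0 \<le> S div b" using Suc.prems assms by (simp add: pos_imp_zdiv_nonneg_iff)
  moreover have "S div b < b ^ N"
  proof -
    have "b * (S div b) \<le> S"
      using minus_mod_eq_mult_div[of S b] pos_mod_sign[of b S] assms(1) by linarith
    also have "S < b * b ^ N" using Suc.prems(2) by simp
    finally show ?thesis using assms(1) by simp
  qed
  ultimately have "S div b = (\<Sum>i<N. (S div b div b ^ i mod b) * b ^ i)" by (rule Suc.IH)
  hence "b * (S div b) = b * (\<Sum>i<N. (S div b div b ^ i mod b) * b ^ i)" by (rule arg_cong)
  also have "\<dots> = (\<Sum>i<N. (S div b ^ Suc i mod b) * b ^ Suc i)"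
    using assms(1) by (simp add: sum_distrib_left zdiv_zmult2_eq mult_ac)
  finally have "b * (S div b) = (\<Sum>i<N. (S div b ^ Suc i mod b) * b ^ Suc i)" .
  moreover have "S = S mod b + b * (S div b)" by simp
  ultimately show ?case by (subst sum.lessThan_Suc_shift) simp
qed simp

text \<open>The defining relation in the integers for the digit functions.\<close>

lemma digit_fun_relation:
  fixes x :: "'n::finite \<Rightarrow> 'p::prime_card mod_ring"
  shows "finite {i. digit_fun i x \<noteq> 0}"
    and "(\<Sum>j\<in>UNIV. to_int_mod_ring (x j)) =
           (\<Sum>i | digit_fun i x \<noteq> 0. to_int_mod_ring (digit_fun i x) * int CARD('p) ^ i)"
proof -
  define S where "S = (\<Sum>j\<in>UNIV. to_int_mod_ring (x j))"
  define b where "b = int CARD('p)"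
  have b: "b > 1" using prime_card_int[where 'a='p] unfolding b_def by (rule prime_gt_1_int)
  have S: "0 \<le> S" unfolding S_def by (intro sum_nonneg to_int_mod_ring_range)
  have lt: "S < b ^ i" if "nat S \<le> i" for i
  proof -
    have "nat S < 2 ^ nat S" by (rule less_exp)
    hence "int (nat S) < int (2 ^ nat S)" by (simp only: of_nat_less_iff)
    hence "S < 2 ^ nat S" using S by simp
    also have "\<dots> \<le> b ^ nat S" using b by (intro power_mono) auto
    also have "\<dots> \<le> b ^ i" using b that by (intro power_increasing) auto
    finally show ?thesis .
  qed
  have z: "digit_fun i x = 0" if "nat S \<le> i" for i
    using lt[OF that] S unfolding digit_fun_def S_def b_def by simp
  hence sub: "{i. digit_fun i x \<noteq> 0} \<subseteq> {..<nat S}" by (force simp: not_less[symmetric])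
  thus "finite {i. digit_fun i x \<noteq> 0}" by (rule finite_subset) simp
  have "S = (\<Sum>i<nat S. (S div b ^ i mod b) * b ^ i)" using b S lt by (intro digit_expansion) auto
  also have "\<dots> = (\<Sum>i<nat S. to_int_mod_ring (digit_fun i x) * b ^ i)"
    by (simp add: to_int_digit_fun S_def b_def)
  also have "\<dots> = (\<Sum>i | digit_fun i x \<noteq> 0. to_int_mod_ring (digit_fun i x) * b ^ i)"
    using sub by (intro sum.mono_neutral_right) (auto simp: zero_mod_ring.rep_eq to_int_mod_ring.rep_eq)
  finally show "(\<Sum>j\<in>UNIV. to_int_mod_ring (x j)) =
       (\<Sum>i | digit_fun i x \<noteq> 0. to_int_mod_ring (digit_fun i x) * int CARD('p) ^ i)"
    unfolding S_def b_def .
qed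

text \<open>
  A polynomial with variables indexed by \<open>'n\<close> maps each exponent vector to its coefficient, with finite
  support; the library's multiplication on \<^type>\<open>poly_mapping\<close> is the convolution product.
\<close>

type_synonym ('n, 'a) mpoly = "('n \<Rightarrow>\<^sub>0 nat) \<Rightarrow>\<^sub>0 'a"

definition Var :: "'n \<Rightarrow> ('n, 'a::comm_ring_1) mpoly" where
  "Var j = Poly_Mapping.single (Poly_Mapping.single j 1) 1"

definition Const :: "'a \<Rightarrow> ('n, 'a::comm_ring_1) mpoly" where
  "Const c = Poly_Mapping.single 0 c"

definition eval_mpoly :: "('n::finite \<Rightarrow> 'a::comm_ring_1) \<Rightarrow> ('n, 'a) mpoly \<Rightarrow> 'a" where
  "eval_mpoly x P =
     (\<Sum>m\<in>Poly_Mapping.keys P.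
        Poly_Mapping.lookup P m * (\<Prod>j\<in>UNIV. x j ^ Poly_Mapping.lookup m j))"

definition degree_in :: "'n \<Rightarrow> ('n, 'a::comm_ring_1) mpoly \<Rightarrow> nat" where
  "degree_in j P = Max (insert 0 ((\<lambda>m. Poly_Mapping.lookup m j) ` Poly_Mapping.keys P))"

definition polynomial_expression ::
  "(('n::finite \<Rightarrow> 'a::comm_ring_1) \<Rightarrow> 'a) \<Rightarrow> ('n, 'a) mpoly \<Rightarrow> bool" where
  "polynomial_expression f P \<longleftrightarrow> (\<forall>x. eval_mpoly x P = f x)"

definition minimal_polynomial_expression ::
  "(('n::finite \<Rightarrow> 'p::prime_card mod_ring) \<Rightarrow> 'p mod_ring) \<Rightarrow> ('n, 'p mod_ring) mpoly" where
  "minimal_polynomial_expression f =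
     (THE P. polynomial_expression f P \<and> (\<forall>j. degree_in j P \<le> CARD('p) - 1))"

lemma eval_mpoly_superset:
  assumes "finite A" "Poly_Mapping.keys P \<subseteq> A"
  shows "eval_mpoly x P =
    (\<Sum>m\<in>A. Poly_Mapping.lookup P m * (\<Prod>j\<in>UNIV. x j ^ Poly_Mapping.lookup m j))"
  unfolding eval_mpoly_def using assms
  by (intro sum.mono_neutral_left) (auto simp: in_keys_iff)

lemma eval_mpoly_0 [simp]: "eval_mpoly x 0 = 0"
  by (simp add: eval_mpoly_def)

lemma eval_mpoly_add: "eval_mpoly x (P + Q) = eval_mpoly x P + eval_mpoly x Q"
proof -
  let ?A = "Poly_Mapping.keys P \<union> Poly_Mapping.keys Q"
  have "Poly_Mapping.keys (P + Q) \<subseteq> ?A" by (rule Poly_Mapping.keys_add)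
  thus ?thesis
    by (simp add: eval_mpoly_superset[of ?A] lookup_add distrib_right sum.distrib)
qed

lemma eval_mpoly_uminus: "eval_mpoly x (- P) = - eval_mpoly x P"
  using eval_mpoly_add[of x P "- P"] by (simp add: eq_neg_iff_add_eq_0 add.commute)

lemma eval_mpoly_diff: "eval_mpoly x (P - Q) = eval_mpoly x P - eval_mpoly x Q"
  using eval_mpoly_add[of x P "- Q"] by (simp add: eval_mpoly_uminus)

lemma eval_mpoly_sum: "eval_mpoly x (sum P A) = (\<Sum>a\<in>A. eval_mpoly x (P a))"
  by (induction A rule: infinite_finite_induct) (simp_all add: eval_mpoly_add)

lemma eval_mpoly_single:
  "eval_mpoly x (Poly_Mapping.single m c) = c * (\<Prod>j\<in>UNIV. x j ^ Poly_Mapping.lookup m j)"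
  by (subst eval_mpoly_superset[of "{m}"]) auto

lemma eval_mpoly_mult:
  fixes P Q :: "('n::finite, 'a::comm_ring_1) mpoly"
  shows "eval_mpoly x (P * Q) = eval_mpoly x P * eval_mpoly x Q"
proof -
  let ?s = "\<lambda>P. \<Sum>m\<in>Poly_Mapping.keys P. Poly_Mapping.single m (Poly_Mapping.lookup P m)"
  have eq: "?s P = P" for P :: "('n, 'a) mpoly"
    by (rule poly_mapping_eqI) (auto simp: lookup_sum lookup_single when_def in_keys_iff)
  have "eval_mpoly x (?s P * ?s Q) = eval_mpoly x (?s P) * eval_mpoly x (?s Q)"
    by (simp add: sum_product eval_mpoly_sum mult_single eval_mpoly_single lookup_add power_add
        prod.distrib mult_ac)
  thus ?thesis by (simp only: eq)
qed

lemma eval_mpoly_Const [simp]: "eval_mpoly x (Const c) = c"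
  by (simp add: Const_def eval_mpoly_single)

lemma Const_1: "Const 1 = 1"
  by (simp add: Const_def)

lemma eval_mpoly_1 [simp]: "eval_mpoly x 1 = 1"
  by (metis Const_1 eval_mpoly_Const)

lemma eval_mpoly_Var [simp]: "eval_mpoly x (Var j) = x j"
proof -
  have "(\<Prod>k\<in>UNIV. x k ^ Poly_Mapping.lookup (Poly_Mapping.single j 1) k) =
        (\<Prod>k\<in>UNIV. if k = j then x j else 1)"
    by (intro prod.cong) (auto simp: lookup_single when_def)
  thus ?thesis by (simp add: Var_def eval_mpoly_single)
qed

lemma eval_mpoly_power: "eval_mpoly x (P ^ k) = eval_mpoly x P ^ k"
  by (induction k) (simp_all add: eval_mpoly_mult)

lemma eval_mpoly_prod: "eval_mpoly x (prod P A) = (\<Prod>a\<in>A. eval_mpoly x (P a))"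
  by (induction A rule: infinite_finite_induct) (simp_all add: eval_mpoly_mult)

lemma degree_in_le_iff:
  "degree_in j P \<le> k \<longleftrightarrow> (\<forall>m\<in>Poly_Mapping.keys P. Poly_Mapping.lookup m j \<le> k)"
  by (simp add: degree_in_def)

lemma degree_in_Const: "degree_in j (Const c) \<le> 0"
  unfolding degree_in_le_iff by (auto simp: Const_def split: if_splits)

lemma degree_in_Var: "degree_in j (Var l) \<le> (if j = l then 1 else 0)"
  by (auto simp: degree_in_le_iff Var_def lookup_single when_def)

lemma degree_in_diff:
  assumes "degree_in j P \<le> k" "degree_in j Q \<le> k"
  shows "degree_in j (P - Q) \<le> k"
  using assms unfolding degree_in_le_iff by (auto dest: keys_diff[THEN subsetD])

lemma degree_in_add:
  assumes "degree_in j P \<le> k" "degree_in j Q \<le> k"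
  shows "degree_in j (P + Q) \<le> k"
  using assms unfolding degree_in_le_iff by (auto dest: Poly_Mapping.keys_add[THEN subsetD])

lemma degree_in_0: "degree_in j 0 \<le> k"
  by (simp add: degree_in_le_iff)

lemma degree_in_sum:
  assumes "\<And>a. a \<in> A \<Longrightarrow> degree_in j (P a) \<le> k"
  shows "degree_in j (sum P A) \<le> k"
  using assms by (induction A rule: infinite_finite_induct) (auto intro: degree_in_add degree_in_0)

lemma degree_in_mult:
  assumes "degree_in j P \<le> k" "degree_in j Q \<le> l"
  shows "degree_in j (P * Q) \<le> k + l"
  unfolding degree_in_le_iff
proof
  fix m assume "m \<in> Poly_Mapping.keys (P * Q)"
  then obtain a b where "m = a + b" "a \<in> Poly_Mapping.keys P" "b \<in> Poly_Mapping.keys Q"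
    using keys_mult[of P Q] by blast
  thus "Poly_Mapping.lookup m j \<le> k + l"
    using assms unfolding degree_in_le_iff by (auto simp: lookup_add intro: add_mono)
qed

lemma degree_in_1: "degree_in j 1 \<le> k"
  using order_trans[OF degree_in_Const[of j 1] le0[of k]] by (simp only: Const_1)

lemma degree_in_power:
  assumes "degree_in j P \<le> k"
  shows "degree_in j (P ^ r) \<le> r * k"
proof (induction r)
  case (Suc r)
  show ?case using degree_in_mult[OF assms Suc] by simp
qed (simp add: degree_in_1[of _ 0, simplified])

lemma degree_in_prod:
  assumes "\<And>a. a \<in> A \<Longrightarrow> degree_in j (P a) \<le> g a"
  shows "degree_in j (prod P A) \<le> sum g A"
  using assms
  by (induction A rule: infinite_finite_induct)
     (auto intro: degree_in_mult simp: degree_in_1[of _ 0, simplified])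

lemma mod_ring_power_card:
  fixes a :: "'p::prime_card mod_ring"
  assumes "a \<noteq> 0"
  shows "a ^ (CARD('p) - 1) = 1"
proof -
  have inj: "inj ((*) a)" using assms by (auto intro: injI)
  have "bij_betw ((*) a) (UNIV - {0}) (UNIV - {0})"
    using inj assms finite_UNIV_inj_surj[OF _ inj] unfolding bij_betw_def
    by (simp add: inj_on_def image_set_diff)
  hence "(\<Prod>b\<in>UNIV - {0}. a * b) = \<Prod>(UNIV - {0 :: 'p mod_ring})"
    by (rule prod.reindex_bij_betw)
  moreover have "(\<Prod>b\<in>UNIV - {0}. a * b) = a ^ (CARD('p) - 1) * \<Prod>(UNIV - {0 :: 'p mod_ring})"
    by (simp add: prod.distrib)
  moreover have "\<Prod>(UNIV - {0 :: 'p mod_ring}) \<noteq> 0" by simp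
  ultimately show ?thesis by simp
qed

lemma minimal_polynomial_expression_exists:
  fixes f :: "('n::finite \<Rightarrow> 'p::prime_card mod_ring) \<Rightarrow> 'p mod_ring"
  shows "\<exists>P. polynomial_expression f P \<and> (\<forall>j. degree_in j P \<le> CARD('p) - 1)"
proof -
  let ?q = "CARD('p) - 1"
  have q: "?q > 0" using nontriv[where 'a='p] by simp
  define L :: "('n \<Rightarrow> 'p mod_ring) \<Rightarrow> 'n \<Rightarrow> ('n, 'p mod_ring) mpoly"
    where "L a j = 1 - (Var j - Const (a j)) ^ ?q" for a j
  define P where "P = (\<Sum>a\<in>UNIV. Const (f a) * (\<Prod>j\<in>UNIV. L a j))"
  have evL: "eval_mpoly x (L a j) = (if x j = a j then 1 else 0)" for x a j
    using q mod_ring_power_card[of "x j - a j"]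
    by (simp add: L_def eval_mpoly_diff eval_mpoly_power)
  have evP: "eval_mpoly x (\<Prod>j\<in>UNIV. L a j) = (if a = x then 1 else 0)" for x a
    unfolding eval_mpoly_prod evL by (auto intro!: prod_zero)
  have "eval_mpoly x P = f x" for x
    unfolding P_def eval_mpoly_sum eval_mpoly_mult evP eval_mpoly_Const by (simp add: if_distrib cong: if_cong)
  moreover have "degree_in j P \<le> ?q" for j
  proof -
    have "degree_in j (L a l) \<le> ?q * (if j = l then 1 else 0)" for a l
      unfolding L_def
      by (intro degree_in_diff degree_in_1 degree_in_power degree_in_Var
          order_trans[OF degree_in_Const] le0)
    hence "degree_in j (\<Prod>l\<in>UNIV. L a l) \<le> (\<Sum>l\<in>UNIV. ?q * (if j = l then 1 else 0))" for a
      by (intro degree_in_prod)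
    hence *: "degree_in j (\<Prod>l\<in>UNIV. L a l) \<le> ?q" for a
      by (simp add: sum_distrib_left[symmetric])
    show ?thesis
      unfolding P_def using degree_in_mult[OF degree_in_Const *] by (intro degree_in_sum) simp
  qed
  ultimately show ?thesis unfolding polynomial_expression_def by blast
qed

lemma minimal_polynomial_expression_ex1:
  fixes f :: "('n::finite \<Rightarrow> 'p::prime_card mod_ring) \<Rightarrow> 'p mod_ring"
  shows "\<exists>!P. polynomial_expression f P \<and> (\<forall>j. degree_in j P \<le> CARD('p) - 1)"
proof -
  define B where "B = {P :: ('n, 'p mod_ring) mpoly. \<forall>j. degree_in j P \<le> CARD('p) - 1}"
  define ev where "ev = (\<lambda>(P :: ('n, 'p mod_ring) mpoly) x. eval_mpoly x P)"
  have surj: "ev ` B = UNIV"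
  proof (intro equalityI subset_UNIV subsetI)
    fix g :: "('n \<Rightarrow> 'p mod_ring) \<Rightarrow> 'p mod_ring"
    show "g \<in> ev ` B"
      using minimal_polynomial_expression_exists[of g]
      unfolding B_def ev_def polynomial_expression_def by (auto simp: fun_eq_iff image_iff)
  qed
  define c where "c = (\<lambda>(P :: ('n, 'p mod_ring) mpoly) (x :: 'n \<Rightarrow> 'p mod_ring).
      Poly_Mapping.lookup P (Abs_poly_mapping (\<lambda>j. nat (to_int_mod_ring (x j)))))"
  have inj: "inj_on c B"
  proof (rule inj_onI)
    fix P Q assume PQ: "P \<in> B" "Q \<in> B" "c P = c Q"
    have "Poly_Mapping.lookup P m = Poly_Mapping.lookup Q m" for m
    proof (cases "\<forall>j. Poly_Mapping.lookup m j < CARD('p)")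
      case True
      have "Abs_poly_mapping (\<lambda>j. nat (to_int_mod_ring
              (of_int (int (Poly_Mapping.lookup m j)) :: 'p mod_ring))) = m"
        unfolding to_int_of_int_mod_ring using True by (simp add: lookup_inverse)
      thus ?thesis
        using fun_cong[OF PQ(3), of "\<lambda>j. of_int (int (Poly_Mapping.lookup m j))"]
        by (simp add: c_def)
    next
      case False
      then obtain j where "\<not> Poly_Mapping.lookup m j \<le> CARD('p) - 1"
        using zero_less_card_finite[where 'a='p] by (metis Suc_pred' less_Suc_eq_le)
      hence "m \<notin> Poly_Mapping.keys P" "m \<notin> Poly_Mapping.keys Q"
        using PQ(1,2) unfolding B_def mem_Collect_eq degree_in_le_iff by blast+
      thus ?thesis by (simp add: in_keys_iff)
    qed
    thus "P = Q" by (rule poly_mapping_eqI)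
  qed
  have fin: "finite B" using inj by (rule finite_imageD[rotated]) simp
  have "card B \<le> card (ev ` B)"
    using card_inj_on_le[OF inj subset_UNIV] unfolding surj by simp
  hence "inj_on ev B"
    using fin card_image_le[OF fin, of ev] by (intro eq_card_imp_inj_on) auto
  moreover obtain P where "P \<in> B" "ev P = f" using surj by (metis UNIV_I imageE)
  ultimately have "\<exists>!P. P \<in> B \<and> ev P = f" by (auto dest: inj_onD)
  thus ?thesis
    by (simp add: B_def ev_def polynomial_expression_def fun_eq_iff conj_commute)
qed

text \<open>
  The reduction of a rational number modulo \<open>p = CARD('p)\<close>, meaningful when \<open>p\<close> does not divide its
  denominator. It is computed from the fraction in lowest terms, where \<^const>\<open>inverse\<close> is the
  inverse in the field with \<open>p\<close> elements; the lemma below shows independence of the fraction.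
\<close>

definition rat_residue :: "rat \<Rightarrow> 'p::prime_card mod_ring" where
  "rat_residue a = (case quotient_of a of (\<alpha>, \<beta>) \<Rightarrow> of_int \<alpha> * inverse (of_int \<beta>))"

lemma of_int_mod_ring_eq_0_iff:
  "(of_int k :: 'p::prime_card mod_ring) = 0 \<longleftrightarrow> int CARD('p) dvd k"
proof -
  have "(of_int k :: 'p mod_ring) = 0 \<longleftrightarrow> to_int_mod_ring (of_int k :: 'p mod_ring) = 0"
    by transfer simp
  thus ?thesis by (simp add: to_int_of_int_mod_ring dvd_eq_mod_eq_0)
qed

lemma rat_residue_fraction:
  assumes "coprime \<beta> (int CARD('p::prime_card))"
  shows "(rat_residue (of_int \<alpha> / of_int \<beta>) :: 'p mod_ring) = of_int \<alpha> * inverse (of_int \<beta>)"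
proof -
  have nz: "(of_int \<beta> :: 'p mod_ring) \<noteq> 0" 
    using assms prime_card_int[where 'a='p] unfolding of_int_mod_ring_eq_0_iff
    by (metis coprime_common_divisor dvd_refl not_prime_unit)
  hence \<beta>: "\<beta> \<noteq> 0" by auto
  obtain \<alpha>' \<beta>' where q: "quotient_of (of_int \<alpha> / of_int \<beta>) = (\<alpha>', \<beta>')" by force
  have "\<beta>' > 0" and cop: "coprime \<alpha>' \<beta>'"
    using quotient_of_denom_pos[OF q] quotient_of_coprime[OF q] by auto
  moreover have "(of_int \<alpha> / of_int \<beta> :: rat) = of_int \<alpha>' / of_int \<beta>'" using q by (rule quotient_of_div)
  ultimately have "(of_int (\<alpha> * \<beta>') :: rat) = of_int (\<alpha>' * \<beta>)" using \<beta> by (simp add: field_simps)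
  hence eq: "\<alpha> * \<beta>' = \<alpha>' * \<beta>" by (simp only: of_int_eq_iff)
  hence "\<beta>' dvd \<beta>" using cop
    by (metis coprime_commute coprime_dvd_mult_right_iff dvd_triv_right)
  hence nz': "(of_int \<beta>' :: 'p mod_ring) \<noteq> 0"
    using nz unfolding of_int_mod_ring_eq_0_iff by (metis dvd_trans)
  have "(of_int \<alpha> * of_int \<beta>' :: 'p mod_ring) = of_int \<alpha>' * of_int \<beta>"
    using eq by (metis of_int_mult)
  thus ?thesis using nz nz' by (simp add: rat_residue_def q field_simps)
qed

end

theory Submission
  imports Defs
begin

text \<open>
  At a point \<open>x\<close> whose coordinates have representatives \<open>a\<^sub>j\<close>, the summand indexed by \<open>d\<close> takes the
  value \<open>\<Prod>\<^sub>j (a\<^sub>j choose d\<^sub>j)\<close>. By Vandermonde these add up to \<open>S choose p\<^sup>i\<close> with \<open>S = \<Sum>\<^sub>j a\<^sub>j\<close>, which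
  modulo \<open>p\<close> is \<open>\<lfloor>S / p\<^sup>i\<rfloor>\<close>, since \<open>(1 + X) ^ p\<^sup>i = 1 + X ^ p\<^sup>i\<close> over the field with \<open>p\<close>
  elements. The right-hand side has degree at most \<open>p - 1\<close> in each variable.
\<close>

lemma coeff_one_plus_X_power:
  "coeff ([:1, 1:] ^ n :: 'a::comm_semiring_1 poly) k = of_nat (n choose k)"
proof (cases "k \<le> n")
  case True
  thus ?thesis using coeff_linear_poly_power[of k n 1 1] by simp
next
  case False
  hence "degree ([:1, 1:] ^ n :: 'a poly) < k"
    using degree_power_le[of "[:1, 1:] :: 'a poly" n] by simp
  thus ?thesis using False by (simp add: coeff_eq_0 binomial_eq_0)
qed

text \<open>Write \<open>n = b * q + r\<close> with \<open>b\<close> the prime power and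
  \<open>r < b\<close>. Then \<open>(1 + X) ^ n = (1 + X ^ b) ^ q * (1 + X) ^ r\<close> in
  characteristic p, and the claim compares coefficients of \<open>X ^ b\<close>.\<close>

lemma choose_prime_power:
  fixes n i :: nat
  shows "(of_nat (n choose CARD('p) ^ i) :: 'p::prime_card mod_ring) = of_nat (n div CARD('p) ^ i)"
proof -
  define q r b where "q = n div CARD('p) ^ i" and "r = n mod CARD('p) ^ i" and "b = CARD('p) ^ i"
  have p: "prime CHAR('p mod_ring poly)" by (simp add: prime_card)
  have b: "b > 0" unfolding b_def by simp
  have r: "r < b" using b unfolding r_def b_def by simp
  have X: "[:1, 1:] = 1 + (monom 1 1 :: 'p mod_ring poly)" by (simp add: monom_altdef one_pCons)
  have "[:1, 1:] ^ b = 1 + (monom 1 b :: 'p mod_ring poly)"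
    unfolding X
    by (subst freshmans_dream'[OF p, of b i])
       (simp_all only: b_def semiring_char_poly semiring_char_mod_ring power_one monom_power mult_1)
  moreover have "n = b * q + r" by (simp add: q_def r_def b_def)
  ultimately have "[:1, 1:] ^ n = (1 + monom 1 b) ^ q * ([:1, 1:] ^ r :: 'p mod_ring poly)"
    by (simp only: power_add power_mult)
  also have "(1 + monom 1 b :: 'p mod_ring poly) ^ q = (\<Sum>k\<le>q. of_nat (q choose k) * monom 1 (b * k))"
    by (subst add.commute, subst binomial_ring) (simp add: monom_power)
  also have "coeff (\<dots> * [:1, 1:] ^ r) b =
      (\<Sum>k\<le>q. of_nat (q choose k) * (if b * k \<le> b then of_nat (r choose (b - b * k)) else 0))"
    by (simp add: sum_distrib_right coeff_sum of_nat_poly coeff_monom_mult coeff_one_plus_X_power mult.assoc cong: if_cong)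
  \<comment> \<open>The term \<open>k = 0\<close> contributes \<open>r choose b\<close>, which
    vanishes because \<open>r < b\<close>; for \<open>k > 1\<close> the exponent
    \<open>b * k\<close> exceeds \<open>b\<close>. The intersection is empty when
    \<open>q = 0\<close>.\<close>
  also have "\<dots> = (\<Sum>k\<in>{..q} \<inter> {1}. of_nat (q choose k) * (if b * k \<le> b then of_nat (r choose (b - b * k)) else 0))"
    using r by (intro sum.mono_neutral_right) (auto simp: binomial_eq_0 le_Suc_eq)
  also have "\<dots> = of_nat q"
    by (cases "q = 0") auto
  finally show ?thesis by (simp add: coeff_one_plus_X_power q_def b_def)
qed

lemma prod_monom:
  "(\<Prod>j\<in>A. monom (f j) (g j)) = monom (\<Prod>j\<in>A. f j :: 'a::comm_semiring_1) (\<Sum>j\<in>A. g j)"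
  by (induction A rule: infinite_finite_induct) (simp_all add: mult_monom)

text \<open>Coefficient of \<open>X ^ m\<close> in the product of the powers
  \<open>(1 + X) ^ a j\<close>. A common bound \<open>q\<close> lets all factors be expanded over
  the same range, since binomials with \<open>d j > a j\<close> are zero.\<close>

lemma Vandermonde_fun:
  fixes a :: "'n::finite \<Rightarrow> nat"
  assumes "\<And>j. a j \<le> q"
  shows "(\<Sum>j\<in>UNIV. a j) choose m =
    (\<Sum>d | (\<forall>j. d j \<in> {0..q}) \<and> (\<Sum>j\<in>UNIV. d j) = m. \<Prod>j\<in>UNIV. a j choose d j)"
proof -
  have fin: "finite {d :: 'n \<Rightarrow> nat. \<forall>j. d j \<in> {0..q}}"
    using finite_PiE[of "UNIV :: 'n set" "\<lambda>_. {0..q}"] by (simp add: PiE_def Pi_def extensional_def)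
  have *: "[:1, 1:] ^ a j = (\<Sum>k\<in>{0..q}. monom (a j choose k) k)" for j
    using assms[of j] by (intro poly_eqI) (auto simp: coeff_one_plus_X_power coeff_sum binomial_eq_0 simp del: One_nat_def)
  have "[:1, 1:] ^ (\<Sum>j\<in>UNIV. a j) = (\<Prod>j\<in>UNIV. \<Sum>k\<in>{0..q}. monom (a j choose k) k)"
    by (simp only: power_sum *)
  also have "\<dots> = (\<Sum>d | \<forall>j. d j \<in> {0..q}. \<Prod>j\<in>UNIV. monom (a j choose d j) (d j))"
    by (subst prod_sum_PiE) (auto simp: PiE_def Pi_def extensional_def)
  also have "\<dots> = (\<Sum>d | \<forall>j. d j \<in> {0..q}. monom (\<Prod>j\<in>UNIV. a j choose d j) (\<Sum>j\<in>UNIV. d j))"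
    by (simp add: prod_monom)
  finally have "coeff ([:1, 1:] ^ (\<Sum>j\<in>UNIV. a j)) m = coeff \<dots> m" by (rule arg_cong)
  thus ?thesis
    using fin by (simp add: coeff_one_plus_X_power coeff_sum sum.inter_filter[symmetric] Collect_conj_eq del: One_nat_def)
qed

text \<open>The falling factorial of an integer representative is \<open>fact d\<close> times a
  binomial coefficient, and \<open>fact d\<close> is invertible modulo p because
  \<open>d < CARD('p)\<close>.\<close>

lemma rat_residue_inverse_fact_mult_prod:
  fixes y :: "'p::prime_card mod_ring"
  assumes "d < CARD('p)"
  shows "rat_residue (1 / fact d) * (\<Prod>k<d. y - of_nat k) = of_nat (nat (to_int_mod_ring y) choose d)"
proof -
  define a where "a = nat (to_int_mod_ring y)"
  have y: "y = of_int (int a)"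
    by (simp add: a_def to_int_mod_ring_range of_int_of_int_mod_ring)
  have nd: "\<not> CARD('p) dvd fact d"
    using assms prime_dvd_fact_iff[of "CARD('p)" d] prime_card[where 'a='p] by simp
  hence cop: "coprime (fact d) (int CARD('p))"
    using prime_imp_coprime[OF prime_card_int[where 'a='p], of "fact d"]
    by (metis coprime_commute of_nat_dvd_iff of_nat_fact)
  have nz: "(of_int (fact d) :: 'p mod_ring) \<noteq> 0"
    using nd unfolding of_int_mod_ring_eq_0_iff by (metis of_nat_dvd_iff of_nat_fact)
  have "(\<Prod>k<d. y - of_nat k) = of_int (\<Prod>k<d. int a - int k)" by (simp add: y)
  also have "(\<Prod>k<d. int a - int k) = fact d * int (a choose d)"
  proof -
    \<comment> \<open>Passing to the reals gives access to generalized binomials; the identity also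
      covers \<open>d > a\<close>, where both sides are zero.\<close>
    have "real_of_int (\<Prod>k<d. int a - int k) = real_of_int (fact d * int (a choose d))"
      using gbinomial_mult_fact[of d "real a"]
      by (simp add: binomial_gbinomial[symmetric] atLeast0LessThan)
    thus ?thesis by (simp only: of_int_eq_iff)
  qed
  finally show ?thesis
    using nz rat_residue_fraction[OF cop, of 1] by (simp add: a_def)
qed

theorem theorem1:
  fixes i :: nat
  shows "minimal_polynomial_expression
           (digit_fun i :: ('n::finite \<Rightarrow> 'p::prime_card mod_ring) \<Rightarrow> 'p mod_ring) =
         (\<Sum>d | (\<forall>j. d j \<in> {0..CARD('p) - 1}) \<and> (\<Sum>j\<in>UNIV. d j) = CARD('p) ^ i.
            \<Prod>j\<in>UNIV. Const (rat_residue (1 / fact (d j))) * (\<Prod>k<d j. Var j - of_nat k))"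
    (is "_ = ?P")
proof -
  let ?f = "digit_fun i :: ('n \<Rightarrow> 'p mod_ring) \<Rightarrow> 'p mod_ring"
  let ?q = "CARD('p) - 1"
  have of_nat: "of_nat k = Const (of_nat k :: 'p mod_ring)" for k :: nat
    by (simp add: Const_def)
  have lt: "k \<le> ?q \<longleftrightarrow> k < CARD('p)" for k
    using zero_less_card_finite[where 'a='p] by linarith
  have "eval_mpoly x ?P = ?f x" for x
  proof -
    define a where "a j = nat (to_int_mod_ring (x j))" for j
    have a: "int (a j) = to_int_mod_ring (x j)" for j
      by (simp add: a_def to_int_mod_ring_range)
    have "a j \<le> ?q" for j
      using to_int_mod_ring_range(2)[of "x j"] unfolding lt by (simp flip: a)
    note V = Vandermonde_fun[of a, OF this, of "CARD('p) ^ i"]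
    have "eval_mpoly x ?P =
      (\<Sum>d | (\<forall>j. d j \<in> {0..?q}) \<and> (\<Sum>j\<in>UNIV. d j) = CARD('p) ^ i. \<Prod>j\<in>UNIV. of_nat (a j choose d j))"
      unfolding eval_mpoly_sum eval_mpoly_prod eval_mpoly_mult eval_mpoly_Const eval_mpoly_diff
        eval_mpoly_Var of_nat a_def
      by (intro sum.cong prod.cong refl rat_residue_inverse_fact_mult_prod)
         (subst lt[symmetric], simp)
    also have "\<dots> = of_nat ((\<Sum>j\<in>UNIV. a j) choose CARD('p) ^ i)"
      by (simp add: V)
    \<comment> \<open>Reducing modulo the characteristic does not change the field element, so the
      reduction built into \<open>digit_fun\<close> can be inserted.\<close>
    also have "\<dots> = of_int (int ((\<Sum>j\<in>UNIV. a j) div CARD('p) ^ i) mod int CHAR('p mod_ring))"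
      unfolding choose_prime_power of_int_mod_CHAR by simp
    also have "\<dots> = ?f x"
      by (simp add: digit_fun_def zdiv_int a)
    finally show ?thesis .
  qed
  moreover have "degree_in l ?P \<le> ?q" for l
  proof (intro degree_in_sum)
    fix d :: "'n \<Rightarrow> nat"
    assume d: "d \<in> {d. (\<forall>j. d j \<in> {0..?q}) \<and> (\<Sum>j\<in>UNIV. d j) = CARD('p) ^ i}"
    \<comment> \<open>Only the factor with \<open>j = l\<close> involves the variable
      \<open>l\<close>, through \<open>d l\<close> linear terms; the summand 0 accounts for the
      constant.\<close>
    have "degree_in l (Const (rat_residue (1 / fact (d j)) :: 'p mod_ring) * (\<Prod>k<d j. Var j - of_nat k))
        \<le> 0 + (\<Sum>k<d j. if l = j then 1 else 0)" for j
      unfolding of_nat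
      by (intro degree_in_mult degree_in_Const degree_in_prod degree_in_diff degree_in_Var
          order_trans[OF degree_in_Const] le0)
    hence "degree_in l (\<Prod>j\<in>UNIV. Const (rat_residue (1 / fact (d j)) :: 'p mod_ring) * (\<Prod>k<d j. Var j - of_nat k))
        \<le> (\<Sum>j\<in>UNIV. 0 + (\<Sum>k<d j. if l = j then 1 else 0))"
      by (intro degree_in_prod)
    also have "\<dots> = (\<Sum>j\<in>UNIV. if l = j then d j else 0)"
      by (intro sum.cong) auto
    also have "\<dots> \<le> ?q" using d by simp
    finally show "degree_in l (\<Prod>j\<in>UNIV. Const (rat_residue (1 / fact (d j)) :: 'p mod_ring) *
        (\<Prod>k<d j. Var j - of_nat k)) \<le> ?q" .
  qed
  ultimately show ?thesis
    unfolding minimal_polynomial_expression_def polynomial_expression_def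
    by (intro the1_equality minimal_polynomial_expression_ex1[unfolded polynomial_expression_def]) blast
qed

end
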